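(* Let $\mathfrak{G}$ be a finite class of graphs over a finite vertex set and $\mathcal{M}$ a map assigning to each $\mathcal{G}\in\mathfrak{G}$ a set (model) $\mathcal{M}(\mathcal{G})$. Suppose that (Injectivity) $\mathcal{M}(\mathcal{G}_s)\neq\mathcal{M}(\mathcal{G}_t)$ whenever $\mathcal{G}_s\neq\mathcal{G}_t$, and (Connectedness) for all $\mathcal{G}_s,\mathcal{G}_t\in\mathfrak{G}$ there is a sequence $\mathcal{G}_s=\mathcal{G}_1,\dots,\mathcal{G}_k=\mathcal{G}_t$ in $\mathfrak{G}$, $k\ge 1$, such that for each $i=1,\dots,k-1$ either $\mathcal{M}(\mathcal{G}_i)\subseteq\mathcal{M}(\mathcal{G}_{i+1})$ or $\mathcal{M}(\mathcal{G}_{i+1})\subseteq\mathcal{M}(\mathcal{G}_i)$. Then the model-oriented distance $d_{\mathcal{L}}$ is a metric on $\mathfrak{G}$: (i) $d_{\mathcal{L}}(\mathcal{G}_s,\mathcal{G}_t)=d_{\mathcal{L}}(\mathcal{G}_t,\mathcal{G}_s)$; (ii) $d_{\mathcal{L}}(\mathcal{G}_s,\mathcal{G}_t)\in[0,\infty)$, and $d_{\mathcal{L}}(\mathcal{G}_s,\mathcal{G}_t)=0$ if and only if $\mathcal{G}_s=\mathcal{G}_t$; (iii) $d_{\mathcal{L}}(\mathcal{G}_s,\mathcal{G}_t)\le d_{\mathcal{L}}(\mathcal{G}_s,\mathcal{G})+d_{\mathcal{L}}(\mathcal{G},\mathcal{G}_t)$ for any $\mathcal{G}\in\mathfrak{G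}$.
   Context: $\mathcal{L}=(\mathfrak{G},\preceq)$ is the poset with $\mathcal{G}_1\preceq\mathcal{G}_2$ if and only if $\mathcal{M}(\mathcal{G}_1)\subseteq\mathcal{M}(\mathcal{G}_2)$. An element $y$ covers $x$ ($x\lessdot y$) if $x\prec y$ and there is no $z$ with $x\prec z\prec y$. The model-oriented distance $d_{\mathcal{L}}(\mathcal{G}_s,\mathcal{G}_t)$ is the minimum $d$ for which there is a sequence $(\mathcal{G}_0,\dots,\mathcal{G}_d)$ in $\mathfrak{G}$ with $\mathcal{G}_0=\mathcal{G}_s$, $\mathcal{G}_d=\mathcal{G}_t$ and, for each $1\le i\le d$, $\mathcal{G}_{i-1}\lessdot\mathcal{G}_i$ or $\mathcal{G}_i\lessdot\mathcal{G}_{i-1}$ (i.e. the shortest-path distance in the Hasse diagram). *)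

theory Defs
  imports "HOL-Analysis.Abstract_Metric_Spaces" "HOL-Library.Extended_Nat"
begin

text \<open>
  Graphs may be mixed. An edge is the unordered pair of its two endpoints, each endpoint carrying
  a mark. With marks for tails, arrowheads and circles, for example,
  \<open>{(u, tail), (v, arrowhead)}\<close> is a directed edge, \<open>{(u, tail), (v, tail)}\<close> an undirected one
  and \<open>{(u, arrowhead), (v, arrowhead)}\<close> a bidirected one. Each graph has exactly one
  representation, so equality of graphs is HOL equality. The type of marks is left arbitrary,
  and edges of different kinds may join the same two vertices.
\<close>

record ('v, 'm) mixed_graph =
  nodes :: "'v set"
  edges :: "('v \<times> 'm) set set"

definition graph_over :: "'v set \<Rightarrow> ('v, 'm) mixed_graph \<Rightarrow> bool" where
  "graph_over V G \<longleftrightarrow> nodes G = V \<and>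
     (\<forall>e \<in> edges G. \<exists>u \<in> V. \<exists>v \<in> V. \<exists>a b. e = {(u, a), (v, b)})"

text \<open>
  The order and the distance do not depend on what a graph is, so they are defined for an
  arbitrary type \<^typ>\<open>'g\<close>; \<open>GG\<close> is the class and \<open>M\<close> the model map.
\<close>

definition model_le :: "('g \<Rightarrow> 'x set) \<Rightarrow> 'g \<Rightarrow> 'g \<Rightarrow> bool" where
  "model_le M x y \<longleftrightarrow> M x \<subseteq> M y"

definition model_less :: "('g \<Rightarrow> 'x set) \<Rightarrow> 'g \<Rightarrow> 'g \<Rightarrow> bool" where
  "model_less M x y \<longleftrightarrow> model_le M x y \<and> x \<noteq> y"

definition covered_by :: "'g set \<Rightarrow> ('g \<Rightarrow> 'x set) \<Rightarrow> 'g \<Rightarrow> 'g \<Rightarrow> bool" where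
  "covered_by GG M x y \<longleftrightarrow> x \<in> GG \<and> y \<in> GG \<and> model_less M x y \<and>
     \<not> (\<exists>z \<in> GG. model_less M x z \<and> model_less M z y)"

definition hasse_path :: "'g set \<Rightarrow> ('g \<Rightarrow> 'x set) \<Rightarrow> 'g \<Rightarrow> 'g \<Rightarrow> nat \<Rightarrow> (nat \<Rightarrow> 'g) \<Rightarrow> bool" where
  "hasse_path GG M s t d g \<longleftrightarrow> g 0 = s \<and> g d = t \<and> (\<forall>i \<le> d. g i \<in> GG) \<and>
     (\<forall>i \<in> {1..d}. covered_by GG M (g (i - 1)) (g i) \<or> covered_by GG M (g i) (g (i - 1)))"

text \<open>
  A nonempty set of extended naturals contains its infimum, so this is the minimum length of a
  path whenever there is one; otherwise it is \<open>\<infinity>\<close>.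
\<close>

definition model_dist :: "'g set \<Rightarrow> ('g \<Rightarrow> 'x set) \<Rightarrow> 'g \<Rightarrow> 'g \<Rightarrow> enat" where
  "model_dist GG M s t = Inf {enat d | d. \<exists>g. hasse_path GG M s t d g}"

end

theory Submission
  imports Defs
begin

text \<open>
  Reversing and concatenating paths in the Hasse diagram gives symmetry and the triangle
  inequality. For finiteness, it suffices to join two comparable elements: if \<open>x \<prec> y\<close> is
  not a covering, split it at some \<open>x \<prec> z \<prec> y\<close> and recurse; injectivity makes both
  intervals strictly smaller.
\<close>

lemma hasse_path_refl: "s \<in> GG \<Longrightarrow> hasse_path GG M s s 0 (\<lambda>_. s)"
  by (simp add: hasse_path_def)

lemma hasse_path_covered_by:
  assumes "covered_by GG M x y"
  shows "hasse_path GG M x y 1 (\<lambda>i. if i = 0 then x else y)"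
  using assms by (auto simp: hasse_path_def covered_by_def)

lemma hasse_path_rev:
  assumes "hasse_path GG M s t d g"
  shows "hasse_path GG M t s d (\<lambda>i. g (d - i))"
  unfolding hasse_path_def
proof (intro conjI ballI allI impI)
  fix i assume i: "i \<in> {1..d}"
  \<comment> \<open>The \<open>i\<close>-th step of the reversed sequence runs backwards along the
    step of \<open>g\<close> ending at index \<open>Suc (d - i)\<close>. The covering condition is
    symmetric in its two disjuncts, so only their order changes.\<close>
  then have "Suc (d - i) \<in> {1..d}" and eq: "d - (i - 1) = Suc (d - i)"
    by auto
  then have "covered_by GG M (g (Suc (d - i) - 1)) (g (Suc (d - i))) \<or>
      covered_by GG M (g (Suc (d - i))) (g (Suc (d - i) - 1))"
    using assms unfolding hasse_path_def by blast
  then show "covered_by GG M (g (d - (i - 1))) (g (d - i)) \<or>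
      covered_by GG M (g (d - i)) (g (d - (i - 1)))"
    unfolding eq by auto
qed (use assms in \<open>auto simp: hasse_path_def\<close>)

lemma hasse_path_append:
  assumes p: "hasse_path GG M s u d g" and q: "hasse_path GG M u t e h"
  shows "hasse_path GG M s t (d + e) (\<lambda>i. if i \<le> d then g i else h (i - d))"
    (is "hasse_path _ _ _ _ _ ?f")
  unfolding hasse_path_def
proof (intro conjI ballI allI impI)
  \<comment> \<open>At \<open>j = 0\<close> the conditional still picks \<open>g d\<close>, but
    \<open>g d = u = h 0\<close>, so the two branches agree at the junction.\<close>
  have shift: "?f (d + j) = h j" for j
    using p q by (cases "j = 0") (auto simp: hasse_path_def)
  show "?f 0 = s" using p by (simp add: hasse_path_def)
  show "?f (d + e) = t" unfolding shift using q by (simp add: hasse_path_def)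
  fix i
  show "?f i \<in> GG" if "i \<le> d + e" using that p q by (auto simp: hasse_path_def)
  assume i: "i \<in> {1..d + e}"
  show "covered_by GG M (?f (i - 1)) (?f i) \<or> covered_by GG M (?f i) (?f (i - 1))"
  proof (cases "i \<le> d")
    case True
    then show ?thesis using i p by (auto simp: hasse_path_def)
  next
    case False
    \<comment> \<open>The first step after the junction starts at index \<open>d\<close>, which
      belongs to the \<open>g\<close> branch. Writing both of its ends as \<open>d\<close> plus an
      offset lets \<open>shift\<close> treat it like every other step of \<open>h\<close>.\<close>
    define j where "j = i - d"
    have j: "j \<in> {1..e}" "i = d + j" "i - 1 = d + (j - 1)"
      using False i by (auto simp: j_def)
    show ?thesis unfolding j(3) unfolding j(2) shift
      using q j(1) by (simp add: hasse_path_def)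
  qed
qed

lemma model_dist_le: "hasse_path GG M s t d g \<Longrightarrow> model_dist GG M s t \<le> enat d"
  unfolding model_dist_def by (intro Inf_lower) auto

text \<open>Turns a finite distance into an actual shortest path, which can then be concatenated or
  inspected.\<close>

lemma model_dist_attained:
  assumes "model_dist GG M s t < \<infinity>"
  obtains d g where "hasse_path GG M s t d g" "model_dist GG M s t = enat d"
proof -
  let ?A = "{enat d | d. \<exists>g. hasse_path GG M s t d g}"
  \<comment> \<open>The infimum of the empty set is \<infinity>, so a finite value means that some
    path exists.\<close>
  have nonempty: "?A \<noteq> {}"
    using assms unfolding model_dist_def Inf_enat_def by (cases "?A = {}") simp_all
  then obtain a where "a \<in> ?A"
    by blast
  then have "(LEAST n. n \<in> ?A) \<in> ?A"
    by (rule LeastI[of "\<lambda>n. n \<in> ?A"])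
  then have "Inf ?A \<in> ?A"
    unfolding Inf_enat_def using nonempty by (simp only: if_False)
  then obtain d g where "Inf ?A = enat d" "hasse_path GG M s t d g"
    by blast
  then show ?thesis
    using that unfolding model_dist_def by blast
qed

lemma model_dist_commute: "model_dist GG M s t = model_dist GG M t s"
proof -
  have "(\<exists>g. hasse_path GG M s t d g) \<longleftrightarrow> (\<exists>g. hasse_path GG M t s d g)" for d
    by (auto dest: hasse_path_rev)
  then show ?thesis unfolding model_dist_def by simp
qed

lemma model_dist_triangle:
  "model_dist GG M s t \<le> model_dist GG M s u + model_dist GG M u t"
proof (cases "model_dist GG M s u < \<infinity> \<and> model_dist GG M u t < \<infinity>")
  case True
  then obtain d g e h where
    "hasse_path GG M s u d g" "model_dist GG M s u = enat d"
    "hasse_path GG M u t e h" "model_dist GG M u t = enat e"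
    by (metis model_dist_attained)
  then show ?thesis
    using model_dist_le[OF hasse_path_append, of GG M s u d g t e h] by simp
next
  \<comment> \<open>One summand is \<infinity>, and hence so is the whole right-hand side.\<close>
  case False
  then show ?thesis by auto
qed

lemma model_dist_eq_0_iff:
  assumes "s \<in> GG"
  shows "model_dist GG M s t = 0 \<longleftrightarrow> s = t"
proof
  assume dist_0: "model_dist GG M s t = 0"
  then have "model_dist GG M s t < \<infinity>" by simp
  then obtain d g where "hasse_path GG M s t d g" "model_dist GG M s t = enat d"
    by (rule model_dist_attained)
  \<comment> \<open>A path of length 0 has \<open>g 0\<close> as both its first and its last
    element.\<close>
  then show "s = t"
    using dist_0 by (auto simp: hasse_path_def zero_enat_def)
next
  assume "s = t"
  then show "model_dist GG M s t = 0"
    using model_dist_le[OF hasse_path_refl[OF assms]] by (simp flip: zero_enat_def)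
qed

text \<open>The recursion terminates because the number of elements of \<open>GG\<close> whose
  models lie between \<open>M x\<close> and \<open>M y\<close> decreases; this count is meaningful
  because \<open>GG\<close> is finite.\<close>

lemma hasse_path_comparable:
  assumes fin: "finite GG" and inj: "inj_on M GG"
    and "x \<in> GG" "y \<in> GG" "M x \<subseteq> M y"
  shows "\<exists>d g. hasse_path GG M x y d g"
  using assms(3-5)
proof (induction "card {z \<in> GG. M x \<subseteq> M z \<and> M z \<subseteq> M y}" arbitrary: x y rule: less_induct)
  case less
  let ?I = "\<lambda>x y. {z \<in> GG. M x \<subseteq> M z \<and> M z \<subseteq> M y}"
  show ?case
  proof (cases "x = y \<or> covered_by GG M x y")
    case True
    then show ?thesis
      using hasse_path_refl[OF less.prems(1)] hasse_path_covered_by[of GG M x y] by blast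
  next
    case False
    \<comment> \<open>Since \<open>x\<close> and \<open>y\<close> are distinct and comparable, only
      an intermediate element can prevent a covering.\<close>
    then obtain z where z: "z \<in> GG" "M x \<subseteq> M z" "M z \<subseteq> M y" "x \<noteq> z" "z \<noteq> y"
      using less.prems unfolding covered_by_def model_less_def model_le_def by blast
    \<comment> \<open>\<open>model_less\<close> only says that the graphs differ; injectivity makes
      the inclusions of models strict. Hence \<open>y\<close> drops out of the lower interval and
      \<open>x\<close> out of the upper one.\<close>
    have "M x \<noteq> M z" "M z \<noteq> M y"
      using inj_onD[OF inj] z less.prems by blast+
    then have "?I x z \<subset> ?I x y" "?I z y \<subset> ?I x y"
      using z less.prems by blast+
    then have "card (?I x z) < card (?I x y)" "card (?I z y) < card (?I x y)"
      using fin by (simp_all add: psubset_card_mono)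
    then obtain d g e h where "hasse_path GG M x z d g" "hasse_path GG M z y e h"
      using less.hyps[of x z] less.hyps[of z y] less.prems z by auto
    then show ?thesis by (intro exI) (rule hasse_path_append)
  qed
qed

text \<open>Each link of a chain of comparable elements is replaced by a Hasse path, and these are
  concatenated one after another. Indices start at 1 to match the connectedness hypothesis.\<close>

lemma hasse_path_sequence:
  fixes h :: "nat \<Rightarrow> 'g"
  assumes fin: "finite GG" and inj: "inj_on M GG"
    and mem: "\<forall>i \<in> {1..k}. h i \<in> GG"
    and comp: "\<forall>i \<in> {1..<k}. M (h i) \<subseteq> M (h (i + 1)) \<or> M (h (i + 1)) \<subseteq> M (h i)"
    and "1 \<le> k"
  shows "\<exists>d g. hasse_path GG M (h 1) (h k) d g"
  using \<open>1 \<le> k\<close> mem comp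
proof (induction k rule: dec_induct)
  case base
  then show ?case using hasse_path_refl by force
next
  case (step n)
  obtain d g where "hasse_path GG M (h 1) (h n) d g"
    using step by force
  moreover obtain e f where "hasse_path GG M (h n) (h (Suc n)) e f"
  proof -
    have "h n \<in> GG" "h (Suc n) \<in> GG"
      and "M (h n) \<subseteq> M (h (Suc n)) \<or> M (h (Suc n)) \<subseteq> M (h n)"
      using step by auto
    \<comment> \<open>If the models decrease along this link, the path is built upwards from
      \<open>h (Suc n)\<close> and then reversed.\<close>
    then show ?thesis
      using hasse_path_comparable[OF fin inj, of "h n" "h (Suc n)"]
        hasse_path_comparable[OF fin inj, of "h (Suc n)" "h n"]
      by (auto intro: that dest: hasse_path_rev)
  qed
  ultimately show ?case by (intro exI) (rule hasse_path_append)
qed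

theorem proposition1:
  fixes V :: "'v set"
    and GG :: "('v, 'm) mixed_graph set"
    and M :: "('v, 'm) mixed_graph \<Rightarrow> 'x set"
  assumes finite_vertices: "finite V"
    and graphs: "\<forall>G \<in> GG. graph_over V G"
    and finite_class: "finite GG"
    and injectivity: "\<forall>s \<in> GG. \<forall>t \<in> GG. s \<noteq> t \<longrightarrow> M s \<noteq> M t"
    and connectedness: "\<forall>s \<in> GG. \<forall>t \<in> GG. \<exists>k \<ge> 1. \<exists>h :: nat \<Rightarrow> ('v, 'm) mixed_graph.
          h 1 = s \<and> h k = t \<and> (\<forall>i \<in> {1..k}. h i \<in> GG) \<and>
          (\<forall>i \<in> {1..<k}. M (h i) \<subseteq> M (h (i + 1)) \<or> M (h (i + 1)) \<subseteq> M (h i))"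
  shows "Metric_space GG (\<lambda>s t. real (the_enat (model_dist GG M s t))) \<and>
    (\<forall>s \<in> GG. \<forall>t \<in> GG. model_dist GG M s t = model_dist GG M t s) \<and>
    (\<forall>s \<in> GG. \<forall>t \<in> GG. 0 \<le> model_dist GG M s t \<and> model_dist GG M s t < \<infinity> \<and>
       (model_dist GG M s t = 0 \<longleftrightarrow> s = t)) \<and>
    (\<forall>s \<in> GG. \<forall>t \<in> GG. \<forall>G \<in> GG.
       model_dist GG M s t \<le> model_dist GG M s G + model_dist GG M G t)"
proof -
  have inj: "inj_on M GG" using injectivity by (auto simp: inj_on_def)
  have finite_dist: "model_dist GG M s t < \<infinity>" if st: "s \<in> GG" "t \<in> GG" for s t
  proof -
    from connectedness[THEN bspec, OF st(1), THEN bspec, OF st(2)]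
    have "\<exists>d g. hasse_path GG M s t d g"
    proof (elim exE conjE)
      fix k and h :: "nat \<Rightarrow> ('v, 'm) mixed_graph"
      assume "1 \<le> k" and ends: "h 1 = s" "h k = t" and steps: "\<forall>i \<in> {1..k}. h i \<in> GG"
        "\<forall>i \<in> {1..<k}. M (h i) \<subseteq> M (h (i + 1)) \<or> M (h (i + 1)) \<subseteq> M (h i)"
      from hasse_path_sequence[OF finite_class inj steps \<open>1 \<le> k\<close>] show "\<exists>d g. hasse_path GG M s t d g"
        unfolding ends .
    qed
    then obtain d g where "hasse_path GG M s t d g"
      by blast
    then have "model_dist GG M s t \<le> enat d"
      by (rule model_dist_le)
    then show ?thesis
      by (rule le_less_trans) simp
  qed
  have "Metric_space GG (\<lambda>s t. real (the_enat (model_dist GG M s t)))"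
  proof
    \<comment> \<open>\<open>Metric_space\<close> asks for nonnegativity and symmetry at all points
      of the type, also outside \<open>GG\<close>. Both hold whatever value \<open>the_enat\<close>
      takes at \<infinity>. For the other two axioms, finiteness on \<open>GG\<close> makes the
      conversion to reals faithful.\<close>
    fix s t u
    show "0 \<le> real (the_enat (model_dist GG M s t))" by simp
    show "real (the_enat (model_dist GG M s t)) = real (the_enat (model_dist GG M t s))"
      by (simp add: model_dist_commute)
    assume st: "s \<in> GG" "t \<in> GG"
    obtain a where a: "model_dist GG M s t = enat a"
      using finite_dist[OF st] by (auto simp: less_infinityE)
    show "real (the_enat (model_dist GG M s t)) = 0 \<longleftrightarrow> s = t"
      using model_dist_eq_0_iff[OF st(1), of M t] by (simp add: a zero_enat_def)
    assume u: "u \<in> GG"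
    obtain b c where "model_dist GG M t u = enat b" "model_dist GG M s u = enat c"
      using finite_dist[OF st(2) u] finite_dist[OF st(1) u] by (metis less_infinityE)
    \<comment> \<open>Here the intermediate point is \<open>t\<close>, so the triangle inequality is
      instantiated with \<open>u\<close> as the endpoint.\<close>
    then show "real (the_enat (model_dist GG M s u))
        \<le> real (the_enat (model_dist GG M s t)) + real (the_enat (model_dist GG M t u))"
      using model_dist_triangle[of GG M s u t] a by simp
  qed
  then show ?thesis
    by (intro conjI ballI)
      (assumption | rule finite_dist model_dist_commute model_dist_triangle model_dist_eq_0_iff
        zero_le)+
qed

end
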